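(* Let $\alpha_1,\dots,\alpha_n,\beta_1,\dots,\beta_m$ be weight functions, $\alpha=\prod_i\alpha_i$, $\beta=\prod_j\beta_j$, and $g_{\underline\alpha,\underline\beta}(T)=\alpha^{-1}(1/\beta(T))$. Then every $\Theta\in\mathbf M_{n,m}$ is $(g_{\underline\alpha,\underline\beta},\underline\alpha,\underline\beta)$-Dirichlet, i.e. for every sufficiently large $T$ there is $\mathbf q\in\mathbb Z^m\setminus\{\mathbf0\}$ with $\|\Theta_i\mathbf q\|\le\alpha_i(g_{\underline\alpha,\underline\beta}(T))$ for all $i$ and $|q_j|\le\beta_j(T)$ for all $j$; and hence $\Theta$ is $(g_{\underline\alpha,\underline\beta},\underline\alpha,\underline\beta)$-approximable, i.e. $\|\Theta\mathbf q\|_{\underline\alpha}\le g_{\underline\alpha,\underline\beta}(|\mathbf q|_{\underline\beta})$ for infinitely many $\mathbf q\in\mathbb Z^m\setminus\{\mathbf0\}$.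
   Context: A weight function is a function $h:[0,\infty)\to[0,\infty)$ such that on $[1,\infty)$ it is positive, increasing, continuous, with $h(1)=1$ and $h(T)\to\infty$, extended by $h(T)=1/h(1/T)$ for $0<T\le1$ and $h(0)=0$. $\Theta_i$ is the $i$-th row of $\Theta$, $\|x\|$ the distance of $x\in\mathbb R$ to the nearest integer. $|\mathbf x|_{\underline\beta}=\max_j\beta_j^{-1}(|x_j|)$ for $\mathbf x\in\mathbb R^m$, and $\|\mathbf y\|_{\underline\alpha}=\min_{\mathbf p\in\mathbb Z^n}\max_i\alpha_i^{-1}(|y_i-p_i|)$ for $\mathbf y\in\mathbb R^n$. *)

theory Defs
  imports "HOL-Analysis.Analysis"
begin

text \<open>Functions with domain \<open>[0,\<infinity>)\<close> are modelled as functions on the whole real line whose values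
  at negative arguments are irrelevant. ``Increasing'' means strictly increasing, since the
  inverses of weight functions are used.\<close>

definition weight_function :: "(real \<Rightarrow> real) \<Rightarrow> bool" where
  "weight_function h \<longleftrightarrow>
     h \<in> {0..} \<rightarrow> {0..} \<and>
     (\<forall>T\<ge>1. h T > 0) \<and> strict_mono_on {1..} h \<and> continuous_on {1..} h \<and>
     h 1 = 1 \<and> filterlim h at_top at_top \<and>
     (\<forall>T. 0 < T \<and> T \<le> 1 \<longrightarrow> h T = 1 / h (1 / T)) \<and> h 0 = 0"

text \<open>The inverse is that of the bijection of \<open>[0,\<infinity>)\<close> onto itself; see
  \<open>bij_betw_weight_function\<close>, and \<open>weight_function_prod\<close> for products of weight functions, below.\<close>

definition winv :: "(real \<Rightarrow> real) \<Rightarrow> real \<Rightarrow> real" where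
  "winv h = inv_into {0..} h"

definition nearest_int_dist :: "real \<Rightarrow> real" where
  "nearest_int_dist x = \<bar>x - of_int (round x)\<bar>"

definition real_vec :: "int ^ 'm \<Rightarrow> real ^ 'm" where
  "real_vec q = (\<chi> j. of_int (q $ j))"

definition beta_norm :: "('m::finite \<Rightarrow> real \<Rightarrow> real) \<Rightarrow> real ^ 'm \<Rightarrow> real" where
  "beta_norm \<beta> x = Max (range (\<lambda>j. winv (\<beta> j) \<bar>x $ j\<bar>))"

text \<open>The infimum is attained; see \<open>alpha_dist_attained\<close> below.\<close>

definition alpha_dist :: "('n::finite \<Rightarrow> real \<Rightarrow> real) \<Rightarrow> real ^ 'n \<Rightarrow> real" where
  "alpha_dist \<alpha> y =
     (INF p :: int ^ 'n. Max (range (\<lambda>i. winv (\<alpha> i) \<bar>y $ i - of_int (p $ i)\<bar>)))"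

definition dirichlet ::
  "(real \<Rightarrow> real) \<Rightarrow> ('n::finite \<Rightarrow> real \<Rightarrow> real) \<Rightarrow> ('m::finite \<Rightarrow> real \<Rightarrow> real) \<Rightarrow> real ^ 'm ^ 'n \<Rightarrow> bool"
where
  "dirichlet g \<alpha> \<beta> \<Theta> \<longleftrightarrow>
     (\<forall>\<^sub>F T in at_top. \<exists>q :: int ^ 'm. q \<noteq> 0 \<and>
        (\<forall>i. nearest_int_dist ((\<Theta> *v real_vec q) $ i) \<le> \<alpha> i (g T)) \<and>
        (\<forall>j. \<bar>of_int (q $ j)\<bar> \<le> \<beta> j T))"

definition approximable ::
  "(real \<Rightarrow> real) \<Rightarrow> ('n::finite \<Rightarrow> real \<Rightarrow> real) \<Rightarrow> ('m::finite \<Rightarrow> real \<Rightarrow> real) \<Rightarrow> real ^ 'm ^ 'n \<Rightarrow> bool"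
where
  "approximable g \<alpha> \<beta> \<Theta> \<longleftrightarrow>
     infinite {q :: int ^ 'm. q \<noteq> 0 \<and>
        alpha_dist \<alpha> (\<Theta> *v real_vec q) \<le> g (beta_norm \<beta> (real_vec q))}"

definition dirichlet_fun ::
  "('n::finite \<Rightarrow> real \<Rightarrow> real) \<Rightarrow> ('m::finite \<Rightarrow> real \<Rightarrow> real) \<Rightarrow> real \<Rightarrow> real" where
  "dirichlet_fun \<alpha> \<beta> T = winv (\<lambda>t. \<Prod>i\<in>UNIV. \<alpha> i t) (1 / (\<Prod>j\<in>UNIV. \<beta> j T))"

lemma weight_function_id: "weight_function (\<lambda>x. x)"
  by (auto simp: weight_function_def strict_mono_on_def filterlim_ident)

lemma weight_function_strict_mono:
  assumes "weight_function h"
  shows "strict_mono_on {0..} h"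
proof (rule strict_mono_onI)
  fix r s :: real assume rs: "r \<in> {0..}" "s \<in> {0..}" "r < s"
  from assms have pos: "\<And>T. T \<ge> 1 \<Longrightarrow> h T > 0" and m: "strict_mono_on {1..} h" and h1: "h 1 = 1"
    and e: "\<And>T. 0 < T \<Longrightarrow> T \<le> 1 \<Longrightarrow> h T = 1 / h (1 / T)" and h0: "h 0 = 0"
    by (auto simp: weight_function_def)
  have low: "h a < h b" if "0 < a" "a < b" "b \<le> 1" for a b
  proof -
    have "h (1 / b) < h (1 / a)"
      using that by (intro strict_mono_onD[OF m]) (auto simp: field_simps)
    moreover have "h (1 / b) > 0" using that by (intro pos) (auto simp: field_simps)
    ultimately show ?thesis using that by (simp add: e[of a] e[of b] frac_less2)
  qed
  have high: "h a < h b" if "1 \<le> a" "a < b" for a b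
    using that by (intro strict_mono_onD[OF m]) auto
  have p: "h s > 0" if "s > 0" for s
  proof (cases "s \<ge> 1")
    case False
    then have "h (1 / s) > 0" using that by (intro pos) (auto simp: field_simps)
    then show ?thesis using that False by (simp add: e[of s])
  qed (use pos in auto)
  consider "r = 0" | "0 < r" "s \<le> 1" | "1 \<le> r" | "0 < r" "r < 1" "1 < s"
    using rs by fastforce
  then show "h r < h s"
  proof cases
    case 1 then show ?thesis using p rs h0 by simp
  next
    case 2 then show ?thesis using low rs by simp
  next
    case 3 then show ?thesis using high rs by simp
  next
    case 4
    then show ?thesis using low[of r 1] high[of 1 s] by simp
  qed
qed

lemma bij_betw_weight_function:
  assumes "weight_function h"
  shows "bij_betw h {0..} {0..}"
proof -
  have inj: "inj_on h {0..}"
    using weight_function_strict_mono[OF assms] by (rule strict_mono_on_imp_inj_on)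
  from assms have pos: "\<And>T. T \<ge> 1 \<Longrightarrow> h T > 0" and c: "continuous_on {1..} h" and h1: "h 1 = 1"
    and e: "\<And>T. 0 < T \<Longrightarrow> T \<le> 1 \<Longrightarrow> h T = 1 / h (1 / T)" and h0: "h 0 = 0"
    and lim: "filterlim h at_top at_top" and f: "h \<in> {0..} \<rightarrow> {0..}"
    by (auto simp: weight_function_def)
  have surj1: "\<exists>x\<ge>1. h x = y" if "y \<ge> 1" for y
  proof -
    have "\<forall>\<^sub>F x in at_top. h x \<ge> y \<and> x \<ge> 1"
      using lim eventually_ge_at_top by (auto simp: filterlim_at_top eventually_conj_iff)
    then obtain b where b: "h b \<ge> y" "b \<ge> 1" by (auto simp: eventually_at_top_linorder)
    have "\<exists>x. 1 \<le> x \<and> x \<le> b \<and> h x = y"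
      using b that h1 c by (intro IVT') (auto intro: continuous_on_subset)
    then show ?thesis by blast
  qed
  have "\<exists>x\<ge>0. h x = y" if y: "y \<ge> 0" for y
  proof -
    consider "y = 0" | "0 < y" "y < 1" | "y \<ge> 1" using y by fastforce
    then show ?thesis
    proof cases
      case 1 then show ?thesis using h0 by auto
    next
      case 2
      then obtain x where x: "x \<ge> 1" "h x = 1 / y" using surj1[of "1 / y"] by auto
      then have "h (1 / x) = y" using e[of "1 / x"] by simp
      then show ?thesis using x by (intro exI[of _ "1 / x"]) auto
    next
      case 3
      then obtain x where "x \<ge> 1" "h x = y" using surj1[of y] by blast
      then show ?thesis by (intro exI[of _ x]) auto
    qed
  qed
  then have "h ` {0..} = {0..}" using f by (force simp: image_iff)
  then show ?thesis using inj by (simp add: bij_betw_def)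
qed

lemma weight_function_prod:
  fixes \<alpha> :: "'n::finite \<Rightarrow> real \<Rightarrow> real"
  assumes w: "\<And>i. weight_function (\<alpha> i)"
  shows "weight_function (\<lambda>t. \<Prod>i\<in>UNIV. \<alpha> i t)"
proof -
  have nn: "\<alpha> i t \<ge> 0" if "t \<ge> 0" for i t
    using w[of i] that by (auto simp: weight_function_def)
  have pos: "\<alpha> i t > 0" if "t \<ge> 1" for i t
    using w[of i] that by (auto simp: weight_function_def)
  have ge1: "\<alpha> i t \<ge> 1" if "t \<ge> 1" for i t
    using strict_mono_onD[OF weight_function_strict_mono[OF w[of i]], of 1 t] w[of i] that
    by (cases "t = 1") (auto simp: weight_function_def)
  have lt: "\<alpha> i r < \<alpha> i s" if "1 \<le> r" "r < s" for i r s
    using strict_mono_onD[OF weight_function_strict_mono[OF w[of i]], of r s] that by auto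
  have mono: "strict_mono_on {1..} (\<lambda>t. \<Prod>i\<in>UNIV. \<alpha> i t)"
  proof (rule strict_mono_onI)
    fix r s :: real assume "r \<in> {1..}" "s \<in> {1..}" "r < s"
    then show "(\<Prod>i\<in>UNIV. \<alpha> i r) < (\<Prod>i\<in>UNIV. \<alpha> i s)"
      by (intro prod_mono_strict[of undefined]) (auto intro!: lt pos intro: less_imp_le)
  qed
  have lim: "filterlim (\<lambda>t. \<Prod>i\<in>UNIV. \<alpha> i t) at_top at_top"
  proof (rule filterlim_at_top_mono)
    show "filterlim (\<alpha> undefined) at_top at_top"
      using w[of undefined] by (auto simp: weight_function_def)
    show "\<forall>\<^sub>F t in at_top. \<alpha> undefined t \<le> (\<Prod>i\<in>UNIV. \<alpha> i t)"
      using eventually_ge_at_top[of 1]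
    proof eventually_elim
      case (elim t)
      have "\<alpha> undefined t * 1 \<le> \<alpha> undefined t * (\<Prod>i\<in>UNIV - {undefined}. \<alpha> i t)"
        using elim by (intro mult_left_mono prod_ge_1 ge1) (auto intro: less_imp_le[OF pos])
      then show ?case by (simp add: prod.remove[of UNIV undefined])
    qed
  qed
  have inv: "(\<Prod>i\<in>UNIV. \<alpha> i t) = 1 / (\<Prod>i\<in>UNIV. \<alpha> i (1 / t))" if "0 < t" "t \<le> 1" for t
  proof -
    have "(\<Prod>i\<in>UNIV. \<alpha> i t) = (\<Prod>i\<in>UNIV. 1 / \<alpha> i (1 / t))"
      using w that by (intro prod.cong) (auto simp: weight_function_def)
    then show ?thesis by (simp add: prod_dividef)
  qed
  have "continuous_on {1..} (\<lambda>t. \<Prod>i\<in>UNIV. \<alpha> i t)"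
    using w by (intro continuous_on_prod) (auto simp: weight_function_def)
  moreover have "\<alpha> i 1 = 1" "\<alpha> i 0 = 0" for i
    using w[of i] by (auto simp: weight_function_def)
  ultimately show ?thesis
    unfolding weight_function_def using mono lim inv
    by (auto intro!: prod_nonneg prod_pos nn pos simp: Pi_iff)
qed

lemma winv_mono:
  assumes "weight_function h" "0 \<le> x" "x \<le> y"
  shows "winv h x \<le> winv h y"
proof (rule ccontr)
  assume "\<not> ?thesis"
  then have lt: "winv h y < winv h x" by simp
  have im: "h ` {0..} = {0..}"
    using bij_betw_weight_function[OF assms(1)] by (simp add: bij_betw_def)
  have "winv h z \<in> {0..}" "h (winv h z) = z" if "z \<ge> 0" for z
    using that im inv_into_into[of z h "{0..}"] f_inv_into_f[of z h "{0..}"]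
    by (auto simp: winv_def)
  then show False
    using strict_mono_onD[OF weight_function_strict_mono[OF assms(1)] _ _ lt] assms by force
qed

lemma alpha_dist_attained:
  fixes \<alpha> :: "'n::finite \<Rightarrow> real \<Rightarrow> real" and y :: "real ^ 'n"
  assumes "\<And>i. weight_function (\<alpha> i)"
  defines "F \<equiv> \<lambda>p :: int ^ 'n. Max (range (\<lambda>i. winv (\<alpha> i) \<bar>y $ i - of_int (p $ i)\<bar>))"
  shows "\<exists>p. alpha_dist \<alpha> y = F p \<and> (\<forall>p'. F p \<le> F p')"
proof -
  define p where "p = (\<chi> i. round (y $ i))"
  have min: "F p \<le> F p'" for p'
  proof -
    have "winv (\<alpha> i) \<bar>y $ i - of_int (p $ i)\<bar> \<le> F p'" for i
    proof -
      have "winv (\<alpha> i) \<bar>y $ i - of_int (p $ i)\<bar> \<le> winv (\<alpha> i) \<bar>y $ i - of_int (p' $ i)\<bar>"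
        using round_diff_minimal[of "y $ i" "p' $ i"] by (intro winv_mono assms) (auto simp: p_def)
      also have "\<dots> \<le> F p'" unfolding F_def by (intro Max_ge) auto
      finally show ?thesis .
    qed
    then show ?thesis by (subst F_def) (auto simp: Max_le_iff)
  qed
  moreover have "alpha_dist \<alpha> y = F p"
    unfolding alpha_dist_def F_def[symmetric]
    using min by (intro cInf_eq_minimum) auto
  ultimately show ?thesis by blast
qed

end

theory Submission
  imports Defs
begin

text \<open>The Dirichlet property is Minkowski's theorem on linear forms for the box with sides
  \<open>\<alpha>\<^sub>i(g(T))\<close> and \<open>\<beta>\<^sub>j(T)\<close>, whose product is \<open>1\<close> by the choice of \<open>g\<close>. When the product exceeds \<open>1\<close>,
  Minkowski's theorem follows from the pigeonhole principle for points of \<open>(1/N)\<int>\<^sup>m\<^sup>+\<^sup>n\<close> modulo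
  \<open>\<int>\<^sup>m\<^sup>+\<^sup>n\<close> with \<open>N\<close> large; the boundary case follows because only finitely many integer points compete.

  For approximability, \<open>g\<close> is decreasing, so every Dirichlet solution \<open>q\<close> at \<open>T\<close> is counted. If some
  \<open>\<Theta>q\<close> with \<open>q \<noteq> 0\<close> is integral, the multiples of \<open>q\<close> suffice; otherwise \<open>g(T) \<longlonglongrightarrow> 0\<close> forces infinitely
  many different \<open>q\<close>.\<close>

section \<open>Minkowski's theorem on linear forms\<close>

text \<open>Integer vectors \<open>(a, b)\<close> stand for the grid points
  \<open>(a/N, b/N)\<close>, with \<open>a/N\<close> in a box of sides \<open>B j\<close> and
  \<open>b/N\<close> in a window of sides \<open>A i\<close> just above its image under \<Theta>.
  There are more than N^(m+n) of them, so two agree modulo \<open>N\<close>, and their difference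
  divided by \<open>N\<close> is the required integer point. The 1/N taken off \<open>A i\<close> in
  \<open>big\<close> pays for rounding.\<close>

lemma linear_forms_pigeonhole:
  fixes A :: "'n::finite \<Rightarrow> real" and B :: "'m::finite \<Rightarrow> real" and \<Theta> :: "real ^ 'm ^ 'n"
    and N :: nat
  assumes N: "N > 0" and A: "\<And>i. real N * A i \<ge> 1" and B: "\<And>j. B j > 0"
    and big: "(\<Prod>i\<in>UNIV. A i - 1 / real N) * (\<Prod>j\<in>UNIV. B j) > 1"
  shows "\<exists>(q :: int ^ 'm) (p :: int ^ 'n). (q \<noteq> 0 \<or> p \<noteq> 0) \<and>
    (\<forall>i. \<bar>(\<Theta> *v real_vec q) $ i - of_int (p $ i)\<bar> < A i) \<and> (\<forall>j. \<bar>of_int (q $ j)\<bar> < B j)"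
proof -
  define L where "L = (\<lambda>(a :: 'm \<Rightarrow> int) (i :: 'n). \<Sum>j\<in>UNIV. \<Theta> $ i $ j * real_of_int (a j))"
  define X where "X = PiE UNIV (\<lambda>j. {0..<\<lceil>real N * B j\<rceil>})"
  \<comment> \<open>The window starts at the ceiling of \<open>L a i\<close>, so its length must be
    rounded down to stay below \<open>L a i + N * A i\<close>. Its cardinality then does not depend
    on \<open>a\<close>.\<close>
  define Y where "Y = (\<lambda>a. PiE UNIV (\<lambda>i. {\<lceil>L a i\<rceil>..<\<lceil>L a i\<rceil> + \<lfloor>real N * A i\<rfloor>}))"
  define R where "R = (PiE (UNIV :: 'm set) (\<lambda>j. {0..<int N})) \<times> (PiE (UNIV :: 'n set) (\<lambda>i. {0..<int N}))"
  define f where "f = (\<lambda>(a :: 'm \<Rightarrow> int, b :: 'n \<Rightarrow> int). (\<lambda>j. a j mod int N, \<lambda>i. b i mod int N))"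
  have finX: "finite X" unfolding X_def by (intro finite_PiE) auto
  have finY: "finite (Y a)" for a unfolding Y_def by (intro finite_PiE) auto
  have finR: "finite R" unfolding R_def by (intro finite_cartesian_product finite_PiE) auto
  have cardY: "card (Y a) = (\<Prod>i\<in>UNIV. nat \<lfloor>real N * A i\<rfloor>)" for a
    unfolding Y_def by (subst card_PiE) auto
  have cardX: "card X = (\<Prod>j\<in>UNIV. nat \<lceil>real N * B j\<rceil>)"
    unfolding X_def by (subst card_PiE) auto
  have card: "card (Sigma X Y) = (\<Prod>j\<in>UNIV. nat \<lceil>real N * B j\<rceil>) * (\<Prod>i\<in>UNIV. nat \<lfloor>real N * A i\<rfloor>)"
    using finX finY by (simp add: card_SigmaI cardY cardX)
  have cardR: "card R = N ^ CARD('m) * N ^ CARD('n)"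
    unfolding R_def by (simp add: card_cartesian_product card_PiE)
  have "real (card R) < real (card (Sigma X Y))"
  proof -
    have eA: "(\<Prod>i\<in>UNIV. real N * A i - 1) = real N ^ CARD('n) * (\<Prod>i\<in>UNIV. A i - 1 / real N)"
    proof -
      have "(\<Prod>i\<in>UNIV. real N * A i - 1) = (\<Prod>i\<in>UNIV. real N * (A i - 1 / real N))"
        using N by (intro prod.cong) (auto simp: field_simps)
      then show ?thesis by (simp add: prod.distrib)
    qed
    have eB: "(\<Prod>j\<in>UNIV. real N * B j) = real N ^ CARD('m) * (\<Prod>j\<in>UNIV. B j)"
      by (simp add: prod.distrib)
    have "real (card R) = real N ^ CARD('m) * real N ^ CARD('n) * 1"
      by (simp add: cardR)
    also have "\<dots> < real N ^ CARD('m) * real N ^ CARD('n) *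
        ((\<Prod>i\<in>UNIV. A i - 1 / real N) * (\<Prod>j\<in>UNIV. B j))"
      using N by (intro mult_strict_left_mono big) auto
    also have "\<dots> = (\<Prod>j\<in>UNIV. real N * B j) * (\<Prod>i\<in>UNIV. real N * A i - 1)"
      by (simp add: eA eB)
    \<comment> \<open>Rounding \<open>N * B j\<close> up only helps, and rounding
      \<open>N * A i\<close> down costs at most 1. The factors \<open>N * A i - 1\<close> are
      nonnegative by assumption \<open>A\<close>, as monotonicity of the product requires.\<close>
    also have "\<dots> \<le> (\<Prod>j\<in>UNIV. real (nat \<lceil>real N * B j\<rceil>)) * (\<Prod>i\<in>UNIV. real (nat \<lfloor>real N * A i\<rfloor>))"
    proof (intro mult_mono prod_mono conjI prod_nonneg)
      fix i show "real N * A i - 1 \<le> real (nat \<lfloor>real N * A i\<rfloor>)"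
        using A[of i] by linarith
    next
      fix j show "real N * B j \<le> real (nat \<lceil>real N * B j\<rceil>)" by linarith
    qed (use A B in \<open>auto intro!: mult_nonneg_nonneg intro: less_imp_le\<close>)
    also have "\<dots> = real (card (Sigma X Y))" by (simp add: card)
    finally show ?thesis .
  qed
  then have "card R < card (Sigma X Y)" by simp
  moreover have "f ` Sigma X Y \<subseteq> R" using N by (auto simp: f_def R_def)
  ultimately have "\<not> inj_on f (Sigma X Y)"
    using card_inj_on_le[of f "Sigma X Y" R] finR by auto
  then obtain a b a' b' where ab: "a \<in> X" "b \<in> Y a" "a' \<in> X" "b' \<in> Y a'"
    and ne: "(a, b) \<noteq> (a', b')" and eq: "f (a, b) = f (a', b')"
    by (auto simp: inj_on_def)
  have ma: "a j mod int N = a' j mod int N" and mb: "b i mod int N = b' i mod int N" for i j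
    using eq by (auto simp: f_def dest: fun_cong)
  define q :: "int ^ 'm" where "q = (\<chi> j. (a j - a' j) div int N)"
  define p :: "int ^ 'n" where "p = (\<chi> i. (b i - b' i) div int N)"
  have q: "int N * q $ j = a j - a' j" for j
    using ma[of j] by (simp add: q_def mod_eq_dvd_iff)
  have p: "int N * p $ i = b i - b' i" for i
    using mb[of i] by (simp add: p_def mod_eq_dvd_iff)
  have qr: "real N * real_of_int (q $ j) = real_of_int (a j) - real_of_int (a' j)" for j
    using arg_cong[OF q[of j], of real_of_int] by simp
  have pr: "real N * real_of_int (p $ i) = real_of_int (b i) - real_of_int (b' i)" for i
    using arg_cong[OF p[of i], of real_of_int] by simp
  have "q \<noteq> 0 \<or> p \<noteq> 0"
  proof (rule ccontr)
    assume "\<not> ?thesis"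
    then have "a j = a' j" "b i = b' i" for i j using q[of j] p[of i] by auto
    then show False using ne by auto
  qed
  moreover have "\<bar>(\<Theta> *v real_vec q) $ i - of_int (p $ i)\<bar> < A i" for i
  proof -
    have "real N * (\<Theta> *v real_vec q) $ i = (\<Sum>j\<in>UNIV. \<Theta> $ i $ j * (real N * of_int (q $ j)))"
      by (simp add: matrix_vector_mult_def real_vec_def sum_distrib_left mult_ac)
    also have "\<dots> = L a i - L a' i"
      by (simp add: qr L_def right_diff_distrib sum_subtractf)
    finally have e: "real N * ((\<Theta> *v real_vec q) $ i - of_int (p $ i))
        = (L a i - b i) - (L a' i - b' i)"
      by (simp add: right_diff_distrib pr)
    \<comment> \<open>Both offsets lie in the same half-open interval from 0 to
      \<open>N * A i\<close>, so their difference is strictly smaller than its length. This is the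
      source of the strict inequalities.\<close>
    have bd: "0 \<le> b i - L a i \<and> b i - L a i < real N * A i" if "b \<in> Y a" for a b
    proof -
      have "\<lceil>L a i\<rceil> \<le> b i" "b i < \<lceil>L a i\<rceil> + \<lfloor>real N * A i\<rfloor>"
        using that by (auto simp: Y_def PiE_iff)
      then show ?thesis by linarith
    qed
    have "\<bar>real N * ((\<Theta> *v real_vec q) $ i - of_int (p $ i))\<bar> < real N * A i"
      unfolding e using bd[OF ab(2)] bd[OF ab(4)] by linarith
    then show ?thesis using N by (simp add: abs_mult)
  qed
  moreover have "\<bar>of_int (q $ j)\<bar> < B j" for j
  proof -
    have "0 \<le> a j \<and> real_of_int (a j) < real N * B j" if "a \<in> X" for a
    proof -
      have "0 \<le> a j" "a j < \<lceil>real N * B j\<rceil>" using that by (auto simp: X_def PiE_iff)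
      then show ?thesis by linarith
    qed
    from this[OF ab(1)] this[OF ab(3)]
    have "\<bar>real N * real_of_int (q $ j)\<bar> < real N * B j" unfolding qr by linarith
    then show ?thesis using N by (simp add: abs_mult)
  qed
  ultimately show ?thesis by blast
qed

text \<open>The loss of 1/N disappears as \<open>N\<close> tends to infinity: the perturbed product
  converges to one exceeding 1, so some \<open>N\<close> meets all hypotheses of the pigeonhole
  lemma.\<close>

lemma linear_forms_open:
  fixes A :: "'n::finite \<Rightarrow> real" and B :: "'m::finite \<Rightarrow> real" and \<Theta> :: "real ^ 'm ^ 'n"
  assumes A: "\<And>i. A i > 0" and B: "\<And>j. B j > 0"
    and big: "(\<Prod>i\<in>UNIV. A i) * (\<Prod>j\<in>UNIV. B j) > 1"
  shows "\<exists>(q :: int ^ 'm) (p :: int ^ 'n). (q \<noteq> 0 \<or> p \<noteq> 0) \<and>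
    (\<forall>i. \<bar>(\<Theta> *v real_vec q) $ i - of_int (p $ i)\<bar> < A i) \<and> (\<forall>j. \<bar>of_int (q $ j)\<bar> < B j)"
proof -
  have lim: "(\<lambda>N. A i - 1 / real N) \<longlonglongrightarrow> A i" for i
    using tendsto_diff[OF tendsto_const lim_1_over_n, of "A i"] by simp
  have "(\<lambda>N. (\<Prod>i\<in>UNIV. A i - 1 / real N) * (\<Prod>j\<in>UNIV. B j))
      \<longlonglongrightarrow> (\<Prod>i\<in>UNIV. A i) * (\<Prod>j\<in>UNIV. B j)"
    by (intro tendsto_intros lim)
  then have "\<forall>\<^sub>F N in sequentially. (\<Prod>i\<in>UNIV. A i - 1 / real N) * (\<Prod>j\<in>UNIV. B j) > 1"
    using big by (rule order_tendstoD)
  moreover have "\<forall>\<^sub>F N in sequentially. \<forall>i. A i - 1 / real N > 0"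
    using order_tendstoD(1)[OF lim A] by (intro eventually_all_finite)
  moreover have "\<forall>\<^sub>F N::nat in sequentially. N > 0" by (rule eventually_gt_at_top)
  ultimately have "\<forall>\<^sub>F N::nat in sequentially. N > 0 \<and> (\<forall>i. A i - 1 / real N > 0) \<and>
      (\<Prod>i\<in>UNIV. A i - 1 / real N) * (\<Prod>j\<in>UNIV. B j) > 1"
    by eventually_elim auto
  then obtain N :: nat where N: "N > 0" "\<And>i. A i - 1 / real N > 0"
      "(\<Prod>i\<in>UNIV. A i - 1 / real N) * (\<Prod>j\<in>UNIV. B j) > 1"
    using eventually_happens'[OF sequentially_bot] by blast
  have "real N * A i \<ge> 1" for i
    using N(1) N(2)[of i] by (simp add: field_simps)
  then show ?thesis using N B by (intro linear_forms_pigeonhole[of N]) auto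
qed

section \<open>Finiteness of the candidates and the boundary case\<close>

lemma finite_bounded_int_vec: "finite {q :: int ^ 'm::finite. \<forall>j. \<bar>q $ j\<bar> \<le> C}"
proof -
  have "finite ((\<lambda>f. \<chi> j. f j) ` (PiE UNIV (\<lambda>_. {-C..C})) :: (int ^ 'm) set)"
    by (intro finite_imageI finite_PiE) auto
  moreover have "{q :: int ^ 'm. \<forall>j. \<bar>q $ j\<bar> \<le> C} \<subseteq> (\<lambda>f. \<chi> j. f j) ` (PiE UNIV (\<lambda>_. {-C..C}))"
  proof
    fix q :: "int ^ 'm" assume "q \<in> {q. \<forall>j. \<bar>q $ j\<bar> \<le> C}"
    then have "vec_nth q \<in> PiE UNIV (\<lambda>_. {-C..C})"
      by (auto simp: PiE_iff abs_le_iff minus_le_iff)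
    then show "q \<in> (\<lambda>f. \<chi> j. f j) ` (PiE UNIV (\<lambda>_. {-C..C}))"
      by (intro image_eqI[of _ _ "vec_nth q"]) auto
  qed
  ultimately show ?thesis by (rule finite_subset[rotated])
qed

text \<open>The bounds \<open>B\<close> leave finitely many \<open>q\<close>, and for each of these
  \<open>p\<close> stays within a bounded distance of \<Theta>q. The bound on \<open>p\<close>
  varies with \<open>q\<close>, hence the dependent sum \<open>Sigma\<close> in the proof.\<close>

lemma linear_forms_finite:
  fixes A :: "'n::finite \<Rightarrow> real" and B :: "'m::finite \<Rightarrow> real" and \<Theta> :: "real ^ 'm ^ 'n"
  shows "finite {(q :: int ^ 'm, p :: int ^ 'n).
    (\<forall>i. \<bar>(\<Theta> *v real_vec q) $ i - of_int (p $ i)\<bar> \<le> A i) \<and> (\<forall>j. \<bar>of_int (q $ j)\<bar> \<le> B j)}"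
    (is "finite ?S")
proof -
  define C where "C = \<lfloor>Max (range B)\<rfloor>"
  define P where "P = (\<lambda>q :: int ^ 'm. {p :: int ^ 'n.
    \<forall>i. \<bar>p $ i\<bar> \<le> \<lceil>Max (range (\<lambda>i. A i + \<bar>(\<Theta> *v real_vec q) $ i\<bar>))\<rceil>})"
  have "finite (Sigma {q :: int ^ 'm. \<forall>j. \<bar>q $ j\<bar> \<le> C} P)"
    unfolding P_def by (intro finite_SigmaI finite_bounded_int_vec)
  moreover have "?S \<subseteq> Sigma {q :: int ^ 'm. \<forall>j. \<bar>q $ j\<bar> \<le> C} P"
  proof (clarsimp, intro conjI allI)
    fix q :: "int ^ 'm" and p :: "int ^ 'n"
    assume p: "\<forall>i. \<bar>(\<Theta> *v real_vec q) $ i - of_int (p $ i)\<bar> \<le> A i"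
      and q: "\<forall>j. \<bar>real_of_int (q $ j)\<bar> \<le> B j"
    show "\<bar>q $ j\<bar> \<le> C" for j
    proof -
      have "B j \<le> Max (range B)" by (intro Max_ge) auto
      then show ?thesis unfolding C_def le_floor_iff of_int_abs using q[rule_format, of j] by linarith
    qed
    show "p \<in> P q"
      unfolding P_def
    proof (clarify)
      fix i
      have "A i + \<bar>(\<Theta> *v real_vec q) $ i\<bar> \<le> Max (range (\<lambda>i. A i + \<bar>(\<Theta> *v real_vec q) $ i\<bar>))"
        by (intro Max_ge) auto
      moreover have "real_of_int \<bar>p $ i\<bar> \<le> A i + \<bar>(\<Theta> *v real_vec q) $ i\<bar>"
        using p[rule_format, of i] by linarith
      ultimately have "real_of_int \<bar>p $ i\<bar> \<le> Max (range (\<lambda>i. A i + \<bar>(\<Theta> *v real_vec q) $ i\<bar>))"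
        by linarith
      then show "\<bar>p $ i\<bar> \<le> \<lceil>Max (range (\<lambda>i. A i + \<bar>(\<Theta> *v real_vec q) $ i\<bar>))\<rceil>"
        by linarith
    qed
  qed
  ultimately show ?thesis by (rule finite_subset[rotated])
qed

text \<open>Enlarging all sides by a factor s > 1 makes the product exceed 1, so the open case
  applies. As s decreases to 1 only finitely many candidates are available, and if each of them
  failed at s = 1, all would fail for some s > 1 as well.\<close>

theorem minkowski_linear_forms:
  fixes A :: "'n::finite \<Rightarrow> real" and B :: "'m::finite \<Rightarrow> real" and \<Theta> :: "real ^ 'm ^ 'n"
  assumes A: "\<And>i. A i > 0" and B: "\<And>j. B j > 0"
    and big: "(\<Prod>i\<in>UNIV. A i) * (\<Prod>j\<in>UNIV. B j) \<ge> 1"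
  shows "\<exists>(q :: int ^ 'm) (p :: int ^ 'n). (q \<noteq> 0 \<or> p \<noteq> 0) \<and>
    (\<forall>i. \<bar>(\<Theta> *v real_vec q) $ i - of_int (p $ i)\<bar> \<le> A i) \<and> (\<forall>j. \<bar>of_int (q $ j)\<bar> \<le> B j)"
proof (rule ccontr)
  define P where "P = (\<lambda>s (q :: int ^ 'm, p :: int ^ 'n).
    (\<forall>i. \<bar>(\<Theta> *v real_vec q) $ i - of_int (p $ i)\<bar> \<le> s * A i) \<and> (\<forall>j. \<bar>of_int (q $ j)\<bar> \<le> s * B j))"
  \<comment> \<open>The 2 is an arbitrary cap on s: this one finite set contains the nonzero
    solutions for every s between 1 and 2.\<close>
  define S where "S = {z. P 2 z \<and> z \<noteq> (0, 0)}"
  have "finite {z. P 2 z}"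
    using linear_forms_finite[of \<Theta> "\<lambda>i. 2 * A i" "\<lambda>j. 2 * B j"] by (simp add: P_def)
  then have finS: "finite S" unfolding S_def by (rule rev_finite_subset) auto
  assume "\<not> ?thesis"
  then have neg: "\<not> P 1 z" if "z \<in> S" for z
    using that unfolding S_def P_def by (cases z) (simp, blast)
  have lim: "((\<lambda>s. s * c) \<longlongrightarrow> c) (at_right 1)" for c :: real
    using tendsto_mult_right[OF tendsto_ident_at, of c 1 "{1<..}"] by simp
  have "\<forall>\<^sub>F s in at_right 1. \<not> P s z" if "z \<in> S" for z
  proof -
    obtain q p where z: "z = (q, p)" by (cases z)
    \<comment> \<open>A candidate failing at s = 1 violates some inequality strictly, and that
      inequality remains violated for s slightly above 1.\<close>
    from neg[OF that] consider
        i where "A i < \<bar>(\<Theta> *v real_vec q) $ i - of_int (p $ i)\<bar>" | j where "B j < \<bar>of_int (q $ j)\<bar>"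
      by (auto simp: P_def z not_le)
    then show ?thesis
    proof cases
      case 1
      from order_tendstoD(2)[OF lim 1] show ?thesis
        by eventually_elim (auto simp: P_def z not_le)
    next
      case 2
      from order_tendstoD(2)[OF lim 2] show ?thesis
        by eventually_elim (auto simp: P_def z not_le)
    qed
  qed
  then have "\<forall>\<^sub>F s in at_right 1. \<forall>z\<in>S. \<not> P s z"
    using finS by (intro eventually_ball_finite) auto
  moreover have "\<forall>\<^sub>F s::real in at_right 1. s \<in> {1<..<2}"
    by (rule eventually_at_right_real) simp
  ultimately have "\<forall>\<^sub>F s::real in at_right 1. 1 < s \<and> s < 2 \<and> (\<forall>z\<in>S. \<not> P s z)"
    by eventually_elim auto
  then obtain s :: real where s: "1 < s" "s < 2" "\<And>z. z \<in> S \<Longrightarrow> \<not> P s z"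
    using eventually_happens'[OF trivial_limit_at_right_real] by blast
  have "1 < (\<Prod>i\<in>UNIV. s * A i) * (\<Prod>j\<in>UNIV. s * B j)"
  proof -
    have "1 < s ^ (CARD('n) + CARD('m))" using s by (intro one_less_power) auto
    also have "\<dots> \<le> s ^ (CARD('n) + CARD('m)) * ((\<Prod>i\<in>UNIV. A i) * (\<Prod>j\<in>UNIV. B j))"
      using big s by simp
    also have "\<dots> = (\<Prod>i\<in>UNIV. s * A i) * (\<Prod>j\<in>UNIV. s * B j)"
      by (simp add: prod.distrib power_add)
    finally show ?thesis .
  qed
  then obtain q p where qp: "q \<noteq> 0 \<or> p \<noteq> 0"
      "\<And>i. \<bar>(\<Theta> *v real_vec q) $ i - of_int (p $ i)\<bar> < s * A i" "\<And>j. \<bar>of_int (q $ j)\<bar> < s * B j"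
    using linear_forms_open[of "\<lambda>i. s * A i" "\<lambda>j. s * B j" \<Theta>] A B s by auto
  have "P s (q, p)" using qp by (auto simp: P_def intro: less_imp_le)
  moreover have "P 2 (q, p)"
  proof -
    have "s * A i \<le> 2 * A i" "s * B j \<le> 2 * B j" for i j
      using A[of i] B[of j] s by auto
    with qp(2,3) have "\<bar>(\<Theta> *v real_vec q) $ i - of_int (p $ i)\<bar> \<le> 2 * A i"
        "\<bar>of_int (q $ j)\<bar> \<le> 2 * B j" for i j
      by (meson less_imp_le less_le_trans)+
    then show ?thesis by (simp add: P_def)
  qed
  ultimately show False using s(3)[of "(q, p)"] qp(1) by (auto simp: S_def)
qed

section \<open>Weight functions\<close>

lemma weight_function_strict_monoD:
  assumes "weight_function h" "0 \<le> x" "x < y"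
  shows "h x < h y"
  using strict_mono_onD[OF weight_function_strict_mono[OF assms(1)], of x y] assms by auto

lemma weight_function_monoD:
  assumes "weight_function h" "0 \<le> x" "x \<le> y"
  shows "h x \<le> h y"
  using weight_function_strict_monoD[OF assms(1,2), of y] assms(3) by (cases "x = y") auto

lemma weight_function_0: "weight_function h \<Longrightarrow> h 0 = 0"
  and weight_function_1: "weight_function h \<Longrightarrow> h 1 = 1"
  by (auto simp: weight_function_def)

lemma weight_function_pos: "weight_function h \<Longrightarrow> 0 < x \<Longrightarrow> 0 < h x"
  using weight_function_strict_monoD[of h 0 x] by (simp add: weight_function_0)

lemma winv_nonneg: "weight_function h \<Longrightarrow> 0 \<le> y \<Longrightarrow> 0 \<le> winv h y"
  and weight_function_winv: "weight_function h \<Longrightarrow> 0 \<le> y \<Longrightarrow> h (winv h y) = y"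
  and winv_weight_function: "weight_function h \<Longrightarrow> 0 \<le> x \<Longrightarrow> winv h (h x) = x"
  using bij_betw_weight_function[of h] inv_into_into[of y h "{0..}"]
  by (auto simp: winv_def bij_betw_def f_inv_into_f)

text \<open>A weight function and its inverse are both monotone, so they form a Galois connection.
  It translates bounds on norms built from \<open>winv\<close> into bounds on coordinates.\<close>

lemma winv_le_iff:
  assumes h: "weight_function h" and x: "0 \<le> x" and y: "0 \<le> y"
  shows "winv h y \<le> x \<longleftrightarrow> y \<le> h x"
  using weight_function_monoD[OF h winv_nonneg[OF h y], of x] winv_mono[OF h y, of "h x"]
  by (auto simp: weight_function_winv[OF h y] winv_weight_function[OF h x])

lemma winv_less_iff:
  assumes h: "weight_function h" and x: "0 \<le> x" and y: "0 \<le> y"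
  shows "winv h y < x \<longleftrightarrow> y < h x"
  using weight_function_strict_monoD[OF h winv_nonneg[OF h y], of x]
    weight_function_monoD[OF h x, of "winv h y"]
  by (auto simp: weight_function_winv[OF h y] not_less[symmetric])

section \<open>Sublevel sets of the weighted norm and distance\<close>

lemma beta_norm_le_iff:
  assumes "\<And>j. weight_function (\<beta> j)" "0 \<le> T"
  shows "beta_norm \<beta> x \<le> T \<longleftrightarrow> (\<forall>j. \<bar>x $ j\<bar> \<le> \<beta> j T)"
  using assms by (auto simp: beta_norm_def Max_le_iff winv_le_iff)

lemma beta_norm_nonneg:
  assumes "\<And>j. weight_function (\<beta> j)"
  shows "0 \<le> beta_norm \<beta> x"
proof -
  have "0 \<le> winv (\<beta> undefined) \<bar>x $ undefined\<bar>" by (intro winv_nonneg assms) auto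
  also have "\<dots> \<le> beta_norm \<beta> x" unfolding beta_norm_def by (intro Max_ge) auto
  finally show ?thesis .
qed

text \<open>At level 0 the sublevel box shrinks to the origin. Positivity is needed later because
  \<open>dirichlet_fun\<close> is antitone only on positive arguments: since 1/0 = 0, its value at 0
  is 0.\<close>

lemma beta_norm_pos:
  assumes "\<And>j. weight_function (\<beta> j)" "x \<noteq> 0"
  shows "0 < beta_norm \<beta> x"
proof (rule ccontr)
  assume "\<not> ?thesis"
  then have "beta_norm \<beta> x \<le> 0" by simp
  then have "\<bar>x $ j\<bar> \<le> 0" for j
    using beta_norm_le_iff[of \<beta> 0 x] assms weight_function_0[OF assms(1)] by simp
  then show False using assms(2) by (simp add: vec_eq_iff)
qed

text \<open>Rounding each coordinate is optimal for all coordinates at once, so a single integer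
  vector realises every nearest-integer distance. Attainment of the infimum keeps the inequality
  non-strict.\<close>

lemma alpha_dist_le_iff:
  fixes \<alpha> :: "'n::finite \<Rightarrow> real \<Rightarrow> real"
  assumes \<alpha>: "\<And>i. weight_function (\<alpha> i)" and "0 \<le> r"
  shows "alpha_dist \<alpha> y \<le> r \<longleftrightarrow> (\<forall>i. nearest_int_dist (y $ i) \<le> \<alpha> i r)"
proof -
  let ?F = "\<lambda>p :: int ^ 'n. Max (range (\<lambda>i. winv (\<alpha> i) \<bar>y $ i - of_int (p $ i)\<bar>))"
  obtain p where p: "alpha_dist \<alpha> y = ?F p" "\<And>p'. ?F p \<le> ?F p'"
    using alpha_dist_attained[of \<alpha> y] \<alpha> by blast
  have F: "?F p \<le> r \<longleftrightarrow> (\<forall>i. \<bar>y $ i - of_int (p $ i)\<bar> \<le> \<alpha> i r)" for p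
    using assms by (auto simp: Max_le_iff winv_le_iff)
  show ?thesis
  proof
    assume "alpha_dist \<alpha> y \<le> r"
    then have "\<bar>y $ i - of_int (p $ i)\<bar> \<le> \<alpha> i r" for i using p(1) F by simp
    then show "\<forall>i. nearest_int_dist (y $ i) \<le> \<alpha> i r"
      unfolding nearest_int_dist_def by (meson order_trans round_diff_minimal)
  next
    assume "\<forall>i. nearest_int_dist (y $ i) \<le> \<alpha> i r"
    then have "?F (\<chi> i. round (y $ i)) \<le> r" unfolding F by (simp add: nearest_int_dist_def)
    then show "alpha_dist \<alpha> y \<le> r" using p(1) p(2)[of "\<chi> i. round (y $ i)"] by linarith
  qed
qed

lemma nearest_int_dist_of_int_mult:
  assumes "nearest_int_dist x = 0"
  shows "nearest_int_dist (of_int k * x) = 0"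
proof -
  have "of_int k * x = of_int (k * round x)" using assms by (simp add: nearest_int_dist_def)
  then show ?thesis by (simp only: nearest_int_dist_def round_of_int)
qed

section \<open>The Dirichlet function\<close>

context
  fixes \<alpha> :: "'n::finite \<Rightarrow> real \<Rightarrow> real" and \<beta> :: "'m::finite \<Rightarrow> real \<Rightarrow> real"
  assumes \<alpha>: "\<And>i. weight_function (\<alpha> i)" and \<beta>: "\<And>j. weight_function (\<beta> j)"
begin

lemma weight_function_prod_\<alpha>: "weight_function (\<lambda>t. \<Prod>i\<in>UNIV. \<alpha> i t)"
  and weight_function_prod_\<beta>: "weight_function (\<lambda>t. \<Prod>j\<in>UNIV. \<beta> j t)"
  using weight_function_prod[of \<alpha>] weight_function_prod[of \<beta>] \<alpha> \<beta> by simp_all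

lemma dirichlet_fun_nonneg: "0 \<le> T \<Longrightarrow> 0 \<le> dirichlet_fun \<alpha> \<beta> T"
  unfolding dirichlet_fun_def using weight_function_prod_\<beta>
  by (intro winv_nonneg weight_function_prod_\<alpha>) (auto simp: weight_function_def)

text \<open>This identity is the reason for the choice of \<open>dirichlet_fun\<close>: it puts the
  box exactly at the boundary case of Minkowski's theorem.\<close>

lemma prod_dirichlet_fun:
  assumes "0 < T"
  shows "(\<Prod>i\<in>UNIV. \<alpha> i (dirichlet_fun \<alpha> \<beta> T)) * (\<Prod>j\<in>UNIV. \<beta> j T) = 1"
proof -
  have "(\<Prod>j\<in>UNIV. \<beta> j T) > 0" by (rule weight_function_pos[OF weight_function_prod_\<beta> assms])
  then show ?thesis
    using weight_function_winv[OF weight_function_prod_\<alpha>, of "1 / (\<Prod>j\<in>UNIV. \<beta> j T)"]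
    by (simp add: dirichlet_fun_def del: prod_zero_iff)
qed

lemma dirichlet_fun_antimono:
  assumes "0 < S" "S \<le> T"
  shows "dirichlet_fun \<alpha> \<beta> T \<le> dirichlet_fun \<alpha> \<beta> S"
proof -
  have "(\<Prod>j\<in>UNIV. \<beta> j S) > 0" "(\<Prod>j\<in>UNIV. \<beta> j T) > 0"
    using assms weight_function_pos[OF weight_function_prod_\<beta>] by auto
  moreover have "(\<Prod>j\<in>UNIV. \<beta> j S) \<le> (\<Prod>j\<in>UNIV. \<beta> j T)"
    using weight_function_monoD[OF weight_function_prod_\<beta>, of S T] assms by simp
  ultimately show ?thesis
    unfolding dirichlet_fun_def by (intro winv_mono weight_function_prod_\<alpha>) (auto simp: frac_le)
qed

text \<open>Since the product of the \<alpha> is increasing, the claim amounts to 1/\<beta>(T) <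
  \<alpha>(\<delta>), which holds for large \<open>T\<close> because \<beta> tends to infinity. It
  is applied with \<delta> = 1 to exclude \<open>q = 0\<close>, and with positive distances to
  exclude finiteness.\<close>

lemma eventually_dirichlet_fun_less:
  assumes "0 < \<delta>"
  shows "\<forall>\<^sub>F T in at_top. dirichlet_fun \<alpha> \<beta> T < \<delta>"
proof -
  have pos: "(\<Prod>i\<in>UNIV. \<alpha> i \<delta>) > 0" by (rule weight_function_pos[OF weight_function_prod_\<alpha> assms])
  have "filterlim (\<lambda>T. \<Prod>j\<in>UNIV. \<beta> j T) at_top at_top"
    using weight_function_prod_\<beta> by (simp add: weight_function_def)
  then have "\<forall>\<^sub>F T in at_top. (\<Prod>j\<in>UNIV. \<beta> j T) > 1 / (\<Prod>i\<in>UNIV. \<alpha> i \<delta>)"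
    by (simp add: filterlim_at_top_dense)
  then show ?thesis
  proof eventually_elim
    case (elim T)
    moreover have "(\<Prod>j\<in>UNIV. \<beta> j T) > 0"
      using elim pos by (meson divide_pos_pos less_trans zero_less_one)
    ultimately have "1 / (\<Prod>j\<in>UNIV. \<beta> j T) < (\<Prod>i\<in>UNIV. \<alpha> i \<delta>)"
      using pos by (simp add: field_simps)
    then show ?case
      using \<open>(\<Prod>j\<in>UNIV. \<beta> j T) > 0\<close> assms
      by (simp add: dirichlet_fun_def winv_less_iff[OF weight_function_prod_\<alpha>])
  qed
qed

section \<open>The Dirichlet property and approximability\<close>

lemma dirichlet_dirichlet_fun: "dirichlet (dirichlet_fun \<alpha> \<beta>) \<alpha> \<beta> \<Theta>"
  unfolding dirichlet_def
  using eventually_dirichlet_fun_less[OF zero_less_one] eventually_gt_at_top[of 0]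
proof eventually_elim
  case (elim T)
  define g where "g = dirichlet_fun \<alpha> \<beta> T"
  have prod1: "(\<Prod>i\<in>UNIV. \<alpha> i g) * (\<Prod>j\<in>UNIV. \<beta> j T) = 1"
    unfolding g_def using prod_dirichlet_fun elim by simp
  have "g \<noteq> 0"
    using prod1 weight_function_0[OF weight_function_prod_\<alpha>] mult_zero_left zero_neq_one by metis
  then have g: "0 < g" "g < 1" using dirichlet_fun_nonneg[of T] elim by (auto simp: g_def)
  obtain q p where qp: "q \<noteq> 0 \<or> p \<noteq> 0"
      "\<And>i. \<bar>(\<Theta> *v real_vec q) $ i - of_int (p $ i)\<bar> \<le> \<alpha> i g" "\<And>j. \<bar>of_int (q $ j)\<bar> \<le> \<beta> j T"
    using minkowski_linear_forms[of "\<lambda>i. \<alpha> i g" "\<lambda>j. \<beta> j T" \<Theta>] prod1 g elim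
      weight_function_pos \<alpha> \<beta> by auto
  \<comment> \<open>Minkowski's theorem only gives a nonzero pair. Here \<open>T\<close> being large
    enters: g < 1 makes every bound \<alpha>(g) less than 1, so \<open>q = 0\<close> would force the
    integers \<open>p $ i\<close> to vanish too.\<close>
  have "q \<noteq> 0"
  proof
    assume q: "q = 0"
    have "p $ i = 0" for i
    proof -
      have "(\<Theta> *v real_vec q) $ i = 0"
        by (simp add: q real_vec_def matrix_vector_mult_def)
      with qp(2)[of i] have "\<bar>real_of_int (p $ i)\<bar> \<le> \<alpha> i g" by simp
      also have "\<dots> < 1"
        using weight_function_strict_monoD[OF \<alpha>, of g 1] g weight_function_1[OF \<alpha>] by simp
      finally show ?thesis by linarith
    qed
    with q qp(1) show False by (simp add: vec_eq_iff)
  qed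
  moreover have "nearest_int_dist ((\<Theta> *v real_vec q) $ i) \<le> \<alpha> i g" for i
    unfolding nearest_int_dist_def using qp(2)[of i] round_diff_minimal order_trans by blast
  ultimately show ?case using qp(3) unfolding g_def by blast
qed

lemma approximable_dirichlet_fun: "approximable (dirichlet_fun \<alpha> \<beta>) \<alpha> \<beta> \<Theta>"
  unfolding approximable_def
proof
  let ?g = "dirichlet_fun \<alpha> \<beta>"
  define S where "S = {q :: int ^ 'm. q \<noteq> 0 \<and>
    alpha_dist \<alpha> (\<Theta> *v real_vec q) \<le> ?g (beta_norm \<beta> (real_vec q))}"
  assume "finite {q :: int ^ 'm. q \<noteq> 0 \<and>
    alpha_dist \<alpha> (\<Theta> *v real_vec q) \<le> ?g (beta_norm \<beta> (real_vec q))}"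
  then have fin: "finite S" by (simp add: S_def)
  \<comment> \<open>This rests on the finiteness assumed for contradiction: a nonzero
    \<open>q\<close> at distance 0 would put all its positive multiples into
    \<open>S\<close>.\<close>
  have pos: "alpha_dist \<alpha> (\<Theta> *v real_vec q) > 0" if nz: "q \<noteq> 0" for q :: "int ^ 'm"
  proof (rule ccontr)
    assume "\<not> ?thesis"
    then have "alpha_dist \<alpha> (\<Theta> *v real_vec q) \<le> 0" by simp
    then have *: "nearest_int_dist ((\<Theta> *v real_vec q) $ i) = 0" for i
      using weight_function_0[OF \<alpha>] alpha_dist_le_iff[of \<alpha> 0] \<alpha>
      by (simp add: order_antisym nearest_int_dist_def)
    \<comment> \<open>\<open>Suc k\<close> skips the zero multiple, which \<open>S\<close>
      excludes.\<close>
    define m where "m = (\<lambda>k :: nat. (\<chi> j. int (Suc k) * q $ j) :: int ^ 'm)"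
    obtain j where j: "q $ j \<noteq> 0" using nz by (auto simp: vec_eq_iff)
    have "m k \<in> S" for k
    proof -
      have "m k $ j \<noteq> 0" using j by (simp add: m_def)
      then have "m k \<noteq> 0" by auto
      have e: "(\<Theta> *v real_vec (m k)) $ i = of_int (int (Suc k)) * (\<Theta> *v real_vec q) $ i" for i
        by (simp add: matrix_vector_mult_def real_vec_def m_def sum_distrib_left mult_ac)
      have "nearest_int_dist ((\<Theta> *v real_vec (m k)) $ i) = 0" for i
        unfolding e by (intro nearest_int_dist_of_int_mult *)
      then have "alpha_dist \<alpha> (\<Theta> *v real_vec (m k)) \<le> 0"
        using weight_function_0[OF \<alpha>] alpha_dist_le_iff[of \<alpha> 0] \<alpha> by simp
      also have "0 \<le> ?g (beta_norm \<beta> (real_vec (m k)))"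
        by (intro dirichlet_fun_nonneg beta_norm_nonneg \<beta>)
      finally show ?thesis using \<open>m k \<noteq> 0\<close> by (simp add: S_def)
    qed
    moreover have "inj m"
    proof (rule injI)
      fix k l assume "m k = m l"
      then have "m k $ j = m l $ j" by simp
      then show "k = l" using j by (simp add: m_def)
    qed
    ultimately show False using fin by (meson finite_subset image_subsetI infinite_UNIV_nat finite_imageD)
  qed
  have "\<forall>\<^sub>F T in at_top. \<forall>q\<in>S. ?g T < alpha_dist \<alpha> (\<Theta> *v real_vec q)"
    using fin by (intro eventually_ball_finite ballI eventually_dirichlet_fun_less pos)
      (auto simp: S_def)
  \<comment> \<open>For large \<open>T\<close> the value g(T) lies below the distances of all the
    finitely many elements of \<open>S\<close>. The Dirichlet solution at \<open>T\<close> has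
    distance at most g(T), yet it belongs to \<open>S\<close>, because its norm is at most
    \<open>T\<close> and g is decreasing.\<close>
  with dirichlet_dirichlet_fun[of \<Theta>, unfolded dirichlet_def] eventually_gt_at_top[of 0]
  have "\<forall>\<^sub>F T :: real in at_top. False"
  proof eventually_elim
    case (elim T)
    then obtain q :: "int ^ 'm" where q: "q \<noteq> 0"
        "\<forall>i. nearest_int_dist ((\<Theta> *v real_vec q) $ i) \<le> \<alpha> i (?g T)"
        "\<forall>j. \<bar>of_int (q $ j)\<bar> \<le> \<beta> j T" by blast
    have le: "alpha_dist \<alpha> (\<Theta> *v real_vec q) \<le> ?g T"
      using alpha_dist_le_iff[of \<alpha> "?g T"] q(2) \<alpha> dirichlet_fun_nonneg elim by simp
    have "real_vec q \<noteq> 0" using q(1) by (simp add: vec_eq_iff real_vec_def)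
    moreover have "beta_norm \<beta> (real_vec q) \<le> T"
      using beta_norm_le_iff[of \<beta> T] \<beta> q(3) elim by (simp add: real_vec_def)
    ultimately have "?g T \<le> ?g (beta_norm \<beta> (real_vec q))"
      by (intro dirichlet_fun_antimono beta_norm_pos \<beta>)
    with le q(1) have "q \<in> S" by (simp add: S_def)
    with elim le show False by force
  qed
  then show False by simp
qed

end

theorem theorem3p1:
  fixes \<alpha> :: "'n::finite \<Rightarrow> real \<Rightarrow> real"
    and \<beta> :: "'m::finite \<Rightarrow> real \<Rightarrow> real"
    and \<Theta> :: "real ^ 'm ^ 'n"
  assumes "\<And>i. weight_function (\<alpha> i)"
    and "\<And>j. weight_function (\<beta> j)"
  shows "dirichlet (dirichlet_fun \<alpha> \<beta>) \<alpha> \<beta> \<Theta> \<and>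
         approximable (dirichlet_fun \<alpha> \<beta>) \<alpha> \<beta> \<Theta>"
  using dirichlet_dirichlet_fun[of \<alpha> \<beta> \<Theta>] approximable_dirichlet_fun[of \<alpha> \<beta> \<Theta>] assms by simp

end
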